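(* Let $f$ be a non-linear metric $f(R)$ gravity model, i.e. $f''(R)\neq 0$. No static spherically symmetric vacuum exterior spacetime, i.e. no exterior of the form $$ds_+^2=A(r)\,dt^2-B(r)\,dr^2-r^2d\Omega_{(2)}^2,$$ can be smoothly matched, in the sense of metric $f(R)$ gravity, to the interior of a collapsing uniform-density dust star.
   Context: Conventions: signature $(+,-,-,-)$, $c=1$, $\kappa=8\pi G>0$, Riemann tensor $R^{\rho}{}_{\sigma\mu\nu}=\partial_\nu\Gamma^\rho_{\sigma\mu}+\Gamma^\rho_{\lambda\nu}\Gamma^\lambda_{\sigma\mu}-(\mu\leftrightarrow\nu)$, $R_{\mu\nu}=R^\lambda{}_{\mu\lambda\nu}$, $R=g^{\mu\nu}R_{\mu\nu}$. $f$ is a smooth real function on an interval, $f_R=f'$. The field equations of metric $f(R)$ gravity are $$f_R(R)R_{\mu\nu}-\tfrac12 f(R)g_{\mu\nu}+(\nabla_\mu\nabla_\nu-g_{\mu\nu}\square)f_R(R)=-\kappa T_{\mu\nu}.$$ Interior (collapsing uniform-density dust star): constants $k\in\mathbb R$, $\rho_0>0$, $\chi_*>0$ with $1-k\chi_*^2>0$, and a smooth scale factor $a(\tau)>0$ on $[0,\tau_c)$ with $a(0)=1$, $\dot a(0)=0$ and $\dot a(\tau)<0$ for $0<\tau<\tau_c$ (collapse). The metric, for $0\le \chi\le\chi_*$, is $$ds_-^2=d\tau^2-a^2(\tau)\left(\frac{d\chi^2}{1-k\chi^2}+\chi^2d\Omega_{(2)}^2\right),$$ and it satisfies the field equations with $T_{\mu\nu}=\rho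 u_\mu u_\nu$, $u=\partial_\tau$, $\rho(\tau)=\rho_0/a^3(\tau)$. Its Ricci scalar is $R^-=6\left(\frac{\dot a^2+k}{a^2}+\frac{\ddot a}{a}\right)$. Exterior: the metric is required to have smooth $A,B>0$ and to solve the field equations with $T_{\mu\nu}=0$. Its Ricci scalar is denoted $R^+$. Matching surface: the timelike hypersurface $\Sigma_*$ given by $\chi=\chi_*$ in interior coordinates and by $t=t_*(\tau)$, $r=r_*(\tau)$ (smooth, $\dot t_*>0$) in exterior coordinates $(t,r,\theta,\varphi)$, with intrinsic coordinates $(\tau,\theta,\varphi)$. Smooth matching: for a quantity $Q$, $[Q]$ is the difference of its values on $\Sigma_*$ computed from the exterior and from the interior. The interior and exterior are smoothly matched in non-linear metric $f(R)$ gravity if all four junction conditions hold along $\Sigma_*$: $[h_{ab}]=0$ (induced metric), $[K_{ab}]=0$ (extrinsic curvature), $[R]=0$, and $[n^\mu\partial_\mu R]=0$, where $n$ is the unit normal to $\Sigma_*$. *)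

theory Defs
  imports "HOL-Analysis.Analysis"
begin

section \<open>Calculus on sets with boundary\<close>

text \<open>Derivatives are taken within the given set, so that they are one-sided at a boundary point.\<close>

definition deriv_on :: "real set \<Rightarrow> (real \<Rightarrow> real) \<Rightarrow> real \<Rightarrow> real" where
  "deriv_on S F x = vector_derivative F (at x within S)"

definition smooth_on :: "real set \<Rightarrow> (real \<Rightarrow> real) \<Rightarrow> bool" where
  "smooth_on S F \<longleftrightarrow> (\<exists>D :: nat \<Rightarrow> real \<Rightarrow> real. (\<forall>x\<in>S. D 0 x = F x) \<and>
     (\<forall>n. \<forall>x\<in>S. (D n has_real_derivative D (Suc n) x) (at x within S)))"

definition partial :: "(real ^ 'n) set \<Rightarrow> 'n \<Rightarrow> (real ^ 'n \<Rightarrow> real) \<Rightarrow> real ^ 'n \<Rightarrow> real" where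
  "partial S i F x =
     vector_derivative (\<lambda>s. F (x + s *\<^sub>R axis i 1)) (at 0 within {s. x + s *\<^sub>R axis i 1 \<in> S})"


section \<open>Curvature of a metric in a coordinate chart\<close>

type_synonym 'n metric = "real ^ 'n \<Rightarrow> real ^ 'n ^ 'n"

definition christoffel ::
    "(real ^ 'n) set \<Rightarrow> 'n metric \<Rightarrow> 'n \<Rightarrow> 'n \<Rightarrow> 'n \<Rightarrow> real ^ 'n \<Rightarrow> real" where
  "christoffel S g \<rho> \<mu> \<nu> x = (\<Sum>\<sigma>\<in>UNIV. matrix_inv (g x) $ \<rho> $ \<sigma> *
     (partial S \<mu> (\<lambda>z. g z $ \<sigma> $ \<nu>) x + partial S \<nu> (\<lambda>z. g z $ \<sigma> $ \<mu>) x
       - partial S \<sigma> (\<lambda>z. g z $ \<mu> $ \<nu>) x)) / 2"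

text \<open>Sign convention: \<open>R\<^sup>\<rho>\<^sub>\<sigma>\<^sub>\<mu>\<^sub>\<nu> = \<partial>\<^sub>\<nu> \<Gamma>\<^sup>\<rho>\<^sub>\<sigma>\<^sub>\<mu> + \<Gamma>\<^sup>\<rho>\<^sub>\<alpha>\<^sub>\<nu> \<Gamma>\<^sup>\<alpha>\<^sub>\<sigma>\<^sub>\<mu> - (\<mu> \<leftrightarrow> \<nu>)\<close>,
  the negative of the one in Misner--Thorne--Wheeler.\<close>

definition riemann ::
    "(real ^ 'n) set \<Rightarrow> 'n metric \<Rightarrow> 'n \<Rightarrow> 'n \<Rightarrow> 'n \<Rightarrow> 'n \<Rightarrow> real ^ 'n \<Rightarrow> real" where
  "riemann S g \<rho> \<sigma> \<mu> \<nu> x =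
     (partial S \<nu> (christoffel S g \<rho> \<sigma> \<mu>) x
       + (\<Sum>\<alpha>\<in>UNIV. christoffel S g \<rho> \<alpha> \<nu> x * christoffel S g \<alpha> \<sigma> \<mu> x))
   - (partial S \<mu> (christoffel S g \<rho> \<sigma> \<nu>) x
       + (\<Sum>\<alpha>\<in>UNIV. christoffel S g \<rho> \<alpha> \<mu> x * christoffel S g \<alpha> \<sigma> \<nu> x))"

definition ricci :: "(real ^ 'n) set \<Rightarrow> 'n metric \<Rightarrow> 'n \<Rightarrow> 'n \<Rightarrow> real ^ 'n \<Rightarrow> real" where
  "ricci S g \<mu> \<nu> x = (\<Sum>\<alpha>\<in>UNIV. riemann S g \<alpha> \<mu> \<alpha> \<nu> x)"

definition ricci_scalar :: "(real ^ 'n) set \<Rightarrow> 'n metric \<Rightarrow> real ^ 'n \<Rightarrow> real" where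
  "ricci_scalar S g x = (\<Sum>\<mu>\<in>UNIV. \<Sum>\<nu>\<in>UNIV. matrix_inv (g x) $ \<mu> $ \<nu> * ricci S g \<mu> \<nu> x)"

definition hessian ::
    "(real ^ 'n) set \<Rightarrow> 'n metric \<Rightarrow> (real ^ 'n \<Rightarrow> real) \<Rightarrow> 'n \<Rightarrow> 'n \<Rightarrow> real ^ 'n \<Rightarrow> real" where
  "hessian S g \<phi> \<mu> \<nu> x = partial S \<mu> (partial S \<nu> \<phi>) x
     - (\<Sum>\<alpha>\<in>UNIV. christoffel S g \<alpha> \<mu> \<nu> x * partial S \<alpha> \<phi> x)"

definition box ::
    "(real ^ 'n) set \<Rightarrow> 'n metric \<Rightarrow> (real ^ 'n \<Rightarrow> real) \<Rightarrow> real ^ 'n \<Rightarrow> real" where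
  "box S g \<phi> x = (\<Sum>\<mu>\<in>UNIV. \<Sum>\<nu>\<in>UNIV. matrix_inv (g x) $ \<mu> $ \<nu> * hessian S g \<phi> \<mu> \<nu> x)"


section \<open>Metric \<open>f(R)\<close> gravity\<close>

definition nonlinear_model :: "real set \<Rightarrow> (real \<Rightarrow> real) \<Rightarrow> bool" where
  "nonlinear_model I f \<longleftrightarrow> is_interval I \<and> interior I \<noteq> {} \<and> smooth_on I f \<and>
     (\<forall>R\<in>I. deriv_on I (deriv_on I f) R \<noteq> 0)"

definition field_equations ::
    "real set \<Rightarrow> (real \<Rightarrow> real) \<Rightarrow> real \<Rightarrow> (real ^ 'n) set \<Rightarrow> 'n metric \<Rightarrow>
     ('n \<Rightarrow> 'n \<Rightarrow> real ^ 'n \<Rightarrow> real) \<Rightarrow> bool" where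
  "field_equations I f \<kappa> S g T \<longleftrightarrow>
     (let R = ricci_scalar S g; f\<^sub>R = (\<lambda>z. deriv_on I f (R z)) in
       \<forall>x\<in>S. R x \<in> I \<and>
         (\<forall>\<mu> \<nu>. f\<^sub>R x * ricci S g \<mu> \<nu> x - 1/2 * f (R x) * g x $ \<mu> $ \<nu>
                 + (hessian S g f\<^sub>R \<mu> \<nu> x - g x $ \<mu> $ \<nu> * box S g f\<^sub>R x) = - \<kappa> * T \<mu> \<nu> x))"

definition dust_tensor ::
    "'n metric \<Rightarrow> (real ^ 'n \<Rightarrow> real) \<Rightarrow> (real ^ 'n \<Rightarrow> real ^ 'n) \<Rightarrow> 'n \<Rightarrow> 'n \<Rightarrow> real ^ 'n \<Rightarrow> real" where
  "dust_tensor g \<rho> u \<mu> \<nu> x = \<rho> x * (g x *v u x) $ \<mu> * (g x *v u x) $ \<nu>"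


section \<open>Interior and exterior\<close>

text \<open>Spacetime coordinates \<open>(\<tau>, \<chi>, \<theta>, \<phi>)\<close> and \<open>(t, r, \<theta>, \<phi>)\<close> are the components
  1, 2, 3, 4 of a vector in \<open>real ^ 4\<close>. The charts omit the centre \<open>\<chi> = 0\<close> and the axis
  \<open>sin \<theta> = 0\<close>, where spherical coordinates degenerate.\<close>

definition diag_matrix :: "real ^ 'n \<Rightarrow> real ^ 'n ^ 'n" where
  "diag_matrix d = (\<chi> i j. if i = j then d $ i else 0)"

definition interior_region :: "real \<Rightarrow> real \<Rightarrow> (real ^ 4) set" where
  "interior_region \<chi>\<^sub>s \<tau>\<^sub>c = {x. x $ 1 \<in> {0..<\<tau>\<^sub>c} \<and> x $ 2 \<in> {0<..\<chi>\<^sub>s} \<and> x $ 3 \<in> {0<..<pi}}"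

definition interior_metric :: "real \<Rightarrow> (real \<Rightarrow> real) \<Rightarrow> 4 metric" where
  "interior_metric k a x = diag_matrix (vector
     [1,
      - ((a (x $ 1))\<^sup>2 / (1 - k * (x $ 2)\<^sup>2)),
      - ((a (x $ 1))\<^sup>2 * (x $ 2)\<^sup>2),
      - ((a (x $ 1))\<^sup>2 * (x $ 2)\<^sup>2 * (sin (x $ 3))\<^sup>2)])"

definition collapsing_dust_star ::
    "real set \<Rightarrow> (real \<Rightarrow> real) \<Rightarrow> real \<Rightarrow> real \<Rightarrow> real \<Rightarrow> real \<Rightarrow> real \<Rightarrow> (real \<Rightarrow> real) \<Rightarrow> bool" where
  "collapsing_dust_star I f \<kappa> k \<rho>\<^sub>0 \<chi>\<^sub>s \<tau>\<^sub>c a \<longleftrightarrow>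
     \<rho>\<^sub>0 > 0 \<and> \<chi>\<^sub>s > 0 \<and> 1 - k * \<chi>\<^sub>s\<^sup>2 > 0 \<and> \<tau>\<^sub>c > 0 \<and>
     smooth_on {0..<\<tau>\<^sub>c} a \<and> (\<forall>\<tau>\<in>{0..<\<tau>\<^sub>c}. a \<tau> > 0) \<and>
     a 0 = 1 \<and> deriv_on {0..<\<tau>\<^sub>c} a 0 = 0 \<and> (\<forall>\<tau>\<in>{0<..<\<tau>\<^sub>c}. deriv_on {0..<\<tau>\<^sub>c} a \<tau> < 0) \<and>
     field_equations I f \<kappa> (interior_region \<chi>\<^sub>s \<tau>\<^sub>c) (interior_metric k a)
       (dust_tensor (interior_metric k a) (\<lambda>x. \<rho>\<^sub>0 / a (x $ 1) ^ 3) (\<lambda>x. axis 1 1))"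

text \<open>\<open>J\<close> is the range of the area radius on which the exterior is defined.\<close>

definition exterior_region :: "real set \<Rightarrow> (real ^ 4) set" where
  "exterior_region J = {x. x $ 2 \<in> J \<and> x $ 3 \<in> {0<..<pi}}"

definition static_metric :: "(real \<Rightarrow> real) \<Rightarrow> (real \<Rightarrow> real) \<Rightarrow> 4 metric" where
  "static_metric A B x = diag_matrix (vector
     [A (x $ 2), - B (x $ 2), - ((x $ 2)\<^sup>2), - ((x $ 2)\<^sup>2 * (sin (x $ 3))\<^sup>2)])"

definition static_vacuum_exterior ::
    "real set \<Rightarrow> (real \<Rightarrow> real) \<Rightarrow> real \<Rightarrow> real set \<Rightarrow> (real \<Rightarrow> real) \<Rightarrow> (real \<Rightarrow> real) \<Rightarrow> bool" where
  "static_vacuum_exterior I f \<kappa> J A B \<longleftrightarrow>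
     is_interval J \<and> open J \<and> J \<subseteq> {0<..} \<and>
     smooth_on J A \<and> smooth_on J B \<and> (\<forall>r\<in>J. A r > 0 \<and> B r > 0) \<and>
     field_equations I f \<kappa> (exterior_region J) (static_metric A B) (\<lambda>\<mu> \<nu> x. 0)"


section \<open>Hypersurfaces and junction conditions\<close>

text \<open>A hypersurface is given by a parametrisation \<open>X\<close>, on a set \<open>D\<close> of intrinsic coordinates,
  of a subset of the chart.\<close>

definition tangent ::
    "(real ^ 'm) set \<Rightarrow> (real ^ 'm \<Rightarrow> real ^ 'n) \<Rightarrow> 'm \<Rightarrow> real ^ 'm \<Rightarrow> real ^ 'n" where
  "tangent D X i y = (\<chi> \<mu>. partial D i (\<lambda>z. X z $ \<mu>) y)"

definition induced_metric ::
    "(real ^ 'm) set \<Rightarrow> 'n metric \<Rightarrow> (real ^ 'm \<Rightarrow> real ^ 'n) \<Rightarrow> 'm \<Rightarrow> 'm \<Rightarrow> real ^ 'm \<Rightarrow> real" where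
  "induced_metric D g X i j y = tangent D X i y \<bullet> (g (X y) *v tangent D X j y)"

text \<open>In signature \<open>(+,-,-,-)\<close> the unit normal of a timelike hypersurface is spacelike, with norm
  \<open>-1\<close>. On both sides it points from the star to the exterior, the direction of growing
  radial coordinate.\<close>

definition outward_unit_normal ::
    "(real ^ 'm) set \<Rightarrow> 4 metric \<Rightarrow> (real ^ 'm \<Rightarrow> real ^ 4) \<Rightarrow> (real ^ 'm \<Rightarrow> real ^ 4) \<Rightarrow> bool" where
  "outward_unit_normal D g X n \<longleftrightarrow>
     (\<forall>y\<in>D. (\<forall>i. tangent D X i y \<bullet> (g (X y) *v n y) = 0) \<and>
            n y \<bullet> (g (X y) *v n y) = -1 \<and> n y $ 2 > 0)"

text \<open>\<open>K\<^sub>i\<^sub>j = e\<^sub>i\<^sup>\<mu> e\<^sub>j\<^sup>\<nu> \<nabla>\<^sub>\<mu> n\<^sub>\<nu>\<close>, using that \<open>e\<^sub>i\<^sup>\<mu> \<partial>\<^sub>\<mu> n\<^sub>\<nu>\<close> is the derivative of \<open>n\<^sub>\<nu>\<close> along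
  the hypersurface.\<close>

definition extrinsic_curvature ::
    "(real ^ 'm) set \<Rightarrow> (real ^ 'n) set \<Rightarrow> 'n metric \<Rightarrow> (real ^ 'm \<Rightarrow> real ^ 'n) \<Rightarrow>
     (real ^ 'm \<Rightarrow> real ^ 'n) \<Rightarrow> 'm \<Rightarrow> 'm \<Rightarrow> real ^ 'm \<Rightarrow> real" where
  "extrinsic_curvature D S g X n i j y =
     (\<Sum>\<nu>\<in>UNIV. tangent D X j y $ \<nu> *
        (partial D i (\<lambda>z. (g (X z) *v n z) $ \<nu>) y
          - (\<Sum>\<mu>\<in>UNIV. \<Sum>\<alpha>\<in>UNIV.
               christoffel S g \<alpha> \<mu> \<nu> (X y) * tangent D X i y $ \<mu> * (g (X y) *v n y) $ \<alpha>)))"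

definition normal_derivative ::
    "(real ^ 'n) set \<Rightarrow> (real ^ 'm \<Rightarrow> real ^ 'n) \<Rightarrow> (real ^ 'm \<Rightarrow> real ^ 'n) \<Rightarrow>
     (real ^ 'n \<Rightarrow> real) \<Rightarrow> real ^ 'm \<Rightarrow> real" where
  "normal_derivative S X n \<phi> y = (\<Sum>\<mu>\<in>UNIV. n y $ \<mu> * partial S \<mu> \<phi> (X y))"

definition junction_conditions ::
    "(real ^ 'm) set \<Rightarrow>
     (real ^ 4) set \<Rightarrow> 4 metric \<Rightarrow> (real ^ 'm \<Rightarrow> real ^ 4) \<Rightarrow>
     (real ^ 4) set \<Rightarrow> 4 metric \<Rightarrow> (real ^ 'm \<Rightarrow> real ^ 4) \<Rightarrow> bool" where
  "junction_conditions D S\<^sub>1 g\<^sub>1 X\<^sub>1 S\<^sub>2 g\<^sub>2 X\<^sub>2 \<longleftrightarrow>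
     (\<exists>n\<^sub>1 n\<^sub>2. outward_unit_normal D g\<^sub>1 X\<^sub>1 n\<^sub>1 \<and> outward_unit_normal D g\<^sub>2 X\<^sub>2 n\<^sub>2 \<and>
       (\<forall>y\<in>D.
         (\<forall>i j. induced_metric D g\<^sub>2 X\<^sub>2 i j y - induced_metric D g\<^sub>1 X\<^sub>1 i j y = 0) \<and>
         (\<forall>i j. extrinsic_curvature D S\<^sub>2 g\<^sub>2 X\<^sub>2 n\<^sub>2 i j y
                - extrinsic_curvature D S\<^sub>1 g\<^sub>1 X\<^sub>1 n\<^sub>1 i j y = 0) \<and>
         ricci_scalar S\<^sub>2 g\<^sub>2 (X\<^sub>2 y) - ricci_scalar S\<^sub>1 g\<^sub>1 (X\<^sub>1 y) = 0 \<and>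
         normal_derivative S\<^sub>2 X\<^sub>2 n\<^sub>2 (ricci_scalar S\<^sub>2 g\<^sub>2) y
           - normal_derivative S\<^sub>1 X\<^sub>1 n\<^sub>1 (ricci_scalar S\<^sub>1 g\<^sub>1) y = 0))"

text \<open>The stellar surface, with intrinsic coordinates \<open>(\<tau>, \<theta>, \<phi>)\<close>.\<close>

definition surface_params :: "real \<Rightarrow> (real ^ 3) set" where
  "surface_params \<tau>\<^sub>c = {y. y $ 1 \<in> {0..<\<tau>\<^sub>c} \<and> y $ 2 \<in> {0<..<pi}}"

definition interior_surface :: "real \<Rightarrow> real ^ 3 \<Rightarrow> real ^ 4" where
  "interior_surface \<chi>\<^sub>s y = vector [y $ 1, \<chi>\<^sub>s, y $ 2, y $ 3]"

definition exterior_surface :: "(real \<Rightarrow> real) \<Rightarrow> (real \<Rightarrow> real) \<Rightarrow> real ^ 3 \<Rightarrow> real ^ 4" where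
  "exterior_surface t\<^sub>s r\<^sub>s y = vector [t\<^sub>s (y $ 1), r\<^sub>s (y $ 1), y $ 2, y $ 3]"

definition smoothly_matched ::
    "real \<Rightarrow> real \<Rightarrow> real \<Rightarrow> (real \<Rightarrow> real) \<Rightarrow> real set \<Rightarrow> (real \<Rightarrow> real) \<Rightarrow> (real \<Rightarrow> real) \<Rightarrow> bool" where
  "smoothly_matched k \<chi>\<^sub>s \<tau>\<^sub>c a J A B \<longleftrightarrow>
     (\<exists>t\<^sub>s r\<^sub>s. smooth_on {0..<\<tau>\<^sub>c} t\<^sub>s \<and> smooth_on {0..<\<tau>\<^sub>c} r\<^sub>s \<and>
       (\<forall>\<tau>\<in>{0..<\<tau>\<^sub>c}. deriv_on {0..<\<tau>\<^sub>c} t\<^sub>s \<tau> > 0 \<and> r\<^sub>s \<tau> \<in> J) \<and>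
       junction_conditions (surface_params \<tau>\<^sub>c)
         (interior_region \<chi>\<^sub>s \<tau>\<^sub>c) (interior_metric k a) (interior_surface \<chi>\<^sub>s)
         (exterior_region J) (static_metric A B) (exterior_surface t\<^sub>s r\<^sub>s))"

end

(* Across the surface the interior scalar curvature depends on proper time alone, so its normal
   derivative vanishes there. Continuity of the normal derivative and staticity of the exterior then
   force dR/dr = 0 on the exterior side at every radius r = a(t) chi_s which the collapsing surface
   sweeps out, and continuity of R makes R constant in the interior. With R constant, the trace of
   the interior field equations is f_R R - 2 f = - kappa rho; its left side is constant, whereas
   rho = rho_0 / a^3 grows during the collapse. *)
theory Submission
  imports Defs
begin

section \<open>Partial derivatives on product sets\<close>

text \<open>\<open>partial\<close> is built on the choice operator \<open>vector_derivative\<close>,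
  so the condition on the normal derivative says something about the exterior only once the exterior
  scalar curvature is known to be differentiable in the radius. That curvature is never expanded in
  \<open>A\<close> and \<open>B\<close>: its differentiability is imported from the interior. The
  induced metric fixes the radius of the surface, and continuity of the curvature then identifies
  the exterior scalar, on the radii swept out, with the interior one composed with the inverse of
  the radius function. Since the collapse starts from rest, that inverse is singular at \<tau> = 0;
  the argument therefore runs on the open time interval, and the initial instant is recovered by
  continuity of the interior curvature. Staticity is used as invariance under shifts of t. It also
  disposes of the time component of the exterior normal, which need not vanish because the surface
  moves.\<close>

lemma vector_4 [simp]:
  "(vector [w, x, y, z] :: 'a :: zero ^ 4) $ 1 = w"
  "(vector [w, x, y, z] :: 'a :: zero ^ 4) $ 2 = x"
  "(vector [w, x, y, z] :: 'a :: zero ^ 4) $ 3 = y"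
  "(vector [w, x, y, z] :: 'a :: zero ^ 4) $ 4 = z"
  unfolding vector_def by simp_all

lemma at_within_translate_nontrivial:
  fixes c :: real
  assumes "at c within E \<noteq> bot"
  shows "at 0 within {s. c + s \<in> E} \<noteq> bot"
proof -
  have "c islimpt E" using assms by (simp add: trivial_limit_within)
  then have "0 islimpt {s. c + s \<in> E}"
    unfolding islimpt_approachable
  proof (intro allI impI)
    fix e :: real
    assume *: "\<forall>e>0. \<exists>x'\<in>E. x' \<noteq> c \<and> dist x' c < e" "0 < e"
    then obtain x' where "x' \<in> E" "x' \<noteq> c" "dist x' c < e" by blast
    then show "\<exists>s\<in>{s. c + s \<in> E}. s \<noteq> 0 \<and> dist s 0 < e"
      by (intro bexI[of _ "x' - c"]) (auto simp: dist_real_def)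
  qed
  then show ?thesis by (simp add: trivial_limit_within)
qed

text \<open>On a product set, a step along axis \<open>i\<close> stays inside exactly when the moved
  coordinate stays in \<open>E i\<close>, so a partial derivative is a one-variable derivative
  translated to 0. Nontriviality of the filter makes the derivative unique, and \<open>F\<close> has
  to be known on \<open>S\<close> only.\<close>

lemma partial_eq:
  fixes F :: "real ^ 'n \<Rightarrow> real"
  assumes S: "S = {x. \<forall>j. x $ j \<in> E j}" and x: "x \<in> S" and nt: "at (x $ i) within E i \<noteq> bot"
    and FG: "\<And>z. z \<in> S \<Longrightarrow> F z = G z"
    and D: "((\<lambda>t. G (\<chi> j. if j = i then t else x $ j)) has_real_derivative D) (at (x $ i) within E i)"
  shows "partial S i F x = D"
proof -
  define T where "T = {s. x + s *\<^sub>R axis i 1 \<in> S}"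
  have upd: "x + s *\<^sub>R axis i 1 = (\<chi> j. if j = i then x $ i + s else x $ j)" for s
    by (simp add: vec_eq_iff axis_def)
  have T: "T = {s. x $ i + s \<in> E i}"
    using x unfolding T_def upd S by auto
  have "(+) (x $ i) ` T = E i"
    unfolding T by (force intro: image_eqI[of _ _ "_ - x $ i"])
  then have "((\<lambda>t. G (\<chi> j. if j = i then t else x $ j)) has_real_derivative D)
      (at (x $ i + 0) within (+) (x $ i) ` T)"
    using D by simp
  moreover have "((+) (x $ i) has_real_derivative 1) (at 0 within T)"
    by (auto intro!: derivative_eq_intros)
  ultimately have "(((\<lambda>t. G (\<chi> j. if j = i then t else x $ j)) \<circ> (+) (x $ i)) has_real_derivative D * 1)
      (at 0 within T)"
    by (rule DERIV_image_chain)
  then have "((\<lambda>s. G (x + s *\<^sub>R axis i 1)) has_vector_derivative D) (at 0 within T)"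
    by (simp add: o_def upd has_real_derivative_iff_has_vector_derivative)
  then have "((\<lambda>s. F (x + s *\<^sub>R axis i 1)) has_vector_derivative D) (at 0 within T)"
    by (rule has_vector_derivative_transform[rotated 2]) (use x FG in \<open>auto simp: T_def\<close>)
  moreover have "at 0 within T \<noteq> bot"
    unfolding T by (rule at_within_translate_nontrivial[OF nt])
  ultimately show ?thesis
    unfolding partial_def T_def by (simp add: vector_derivative_within)
qed

lemma partial_translation_invariant:
  assumes "\<And>z. z + v \<in> S \<longleftrightarrow> z \<in> S" "\<And>z. F (z + v) = F z"
  shows "partial S i F (x + v) = partial S i F x"
proof -
  have *: "x + v + s *\<^sub>R axis i 1 = (x + s *\<^sub>R axis i 1) + v" for s by simp
  show ?thesis unfolding partial_def * assms ..
qed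

text \<open>Every ingredient is made from \<open>g\<close> by \<open>partial\<close> and algebra, so
  a symmetry of chart and metric passes to the scalar curvature without computing it. For the
  exterior the shift is along t.\<close>

lemma ricci_scalar_translation_invariant:
  fixes v :: "real ^ 'n"
  assumes S: "\<And>z. z + v \<in> S \<longleftrightarrow> z \<in> S" and g: "\<And>z. g (z + v) = g z"
  shows "ricci_scalar S g (x + v) = ricci_scalar S g x"
proof -
  note partial_inv = partial_translation_invariant[of v S, OF S]
  have chr: "christoffel S g \<rho> \<mu> \<nu> (z + v) = christoffel S g \<rho> \<mu> \<nu> z" for \<rho> \<mu> \<nu> z
    unfolding christoffel_def by (simp add: partial_inv g)
  show ?thesis
    unfolding ricci_scalar_def ricci_def riemann_def by (simp add: partial_inv chr g)
qed

text \<open>Three orders suffice: the scalar curvature contains the second derivative of the scale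
  factor and is itself differentiated once. The first derivative is kept as \<open>deriv_on\<close>,
  the form in which the sign condition on the collapse is stated.\<close>

lemma smooth_on_derivs:
  assumes "smooth_on S F" and nt: "\<And>x. x \<in> S \<Longrightarrow> at x within S \<noteq> bot"
  obtains F2 F3 where
    "\<And>x. x \<in> S \<Longrightarrow> (F has_real_derivative deriv_on S F x) (at x within S)"
    "\<And>x. x \<in> S \<Longrightarrow> (deriv_on S F has_real_derivative F2 x) (at x within S)"
    "\<And>x. x \<in> S \<Longrightarrow> (F2 has_real_derivative F3 x) (at x within S)"
proof -
  obtain D where D0: "\<And>x. x \<in> S \<Longrightarrow> D 0 x = F x"
    and D: "\<And>n x. x \<in> S \<Longrightarrow> (D n has_real_derivative D (Suc n) x) (at x within S)"
    using assms(1) unfolding smooth_on_def by blast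
  have F: "(F has_real_derivative D 1 x) (at x within S)" if "x \<in> S" for x
    using has_field_derivative_transform_within[OF D[OF that, of 0] zero_less_one that] D0 by simp
  have D1: "deriv_on S F x = D 1 x" if "x \<in> S" for x
    unfolding deriv_on_def using F[OF that] nt[OF that]
    by (intro vector_derivative_within) (auto simp: has_real_derivative_iff_has_vector_derivative)
  have "(deriv_on S F has_real_derivative D 2 x) (at x within S)" if "x \<in> S" for x
    using has_field_derivative_transform_within[OF D[OF that, of 1] zero_less_one that] D1
    by (simp add: numeral_2_eq_2)
  moreover have "(D 2 has_real_derivative D 3 x) (at x within S)" if "x \<in> S" for x
    using D[OF that, of 2] by (simp add: eval_nat_numeral)
  ultimately show thesis using F D1 by (intro that[of "D 2" "D 3"]) auto
qed

section \<open>Diagonal metrics\<close>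

text \<open>\<open>matrix_inv\<close> is a choice, pinned down here by uniqueness of two-sided
  inverses.\<close>

lemma matrix_inv_eqI:
  fixes A B :: "'a :: semiring_1 ^ 'n ^ 'n"
  assumes "A ** B = mat 1" "B ** A = mat 1"
  shows "matrix_inv A = B"
proof -
  let ?C = "matrix_inv A"
  have "A ** ?C = mat 1 \<and> ?C ** A = mat 1"
    unfolding matrix_inv_def by (rule someI[of _ B]) (use assms in simp)
  then have "?C = ?C ** (A ** B)" "?C ** A = mat 1" using assms by auto
  then show ?thesis by (simp add: matrix_mul_assoc)
qed

lemma matrix_inv_diag_matrix:
  fixes d :: "real ^ 'n"
  assumes "\<And>i. d $ i \<noteq> 0"
  shows "matrix_inv (diag_matrix d) = diag_matrix (\<chi> i. 1 / d $ i)"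
proof -
  have "diag_matrix d ** diag_matrix (\<chi> i. 1 / d $ i) = mat 1"
    "diag_matrix (\<chi> i. 1 / d $ i) ** diag_matrix d = mat 1"
    using assms
    by (simp_all add: diag_matrix_def matrix_matrix_mult_def mat_def vec_eq_iff
        if_distrib[of "\<lambda>u. u * _"] cong: if_cong)
  then show ?thesis by (rule matrix_inv_eqI)
qed

lemma diag_matrix_mult_vector [simp]: "(diag_matrix d *v u) $ i = d $ i * u $ i"
  for d u :: "real ^ 'n"
  by (simp add: diag_matrix_def matrix_vector_mult_def if_distrib[of "\<lambda>u. u * _"] cong: if_cong)

section \<open>Curvature of the interior\<close>

locale flrw_interior =
  fixes k \<chi>\<^sub>s \<tau>\<^sub>c :: real and a a1 a2 a3 :: "real \<Rightarrow> real"
  assumes \<chi>\<^sub>s_pos: "\<chi>\<^sub>s > 0" and curv_pos: "1 - k * \<chi>\<^sub>s\<^sup>2 > 0" and \<tau>\<^sub>c_pos: "\<tau>\<^sub>c > 0"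
    and a_pos: "\<And>t. t \<in> {0..<\<tau>\<^sub>c} \<Longrightarrow> a t > 0"
    and a_deriv: "\<And>t. t \<in> {0..<\<tau>\<^sub>c} \<Longrightarrow> (a has_real_derivative a1 t) (at t within {0..<\<tau>\<^sub>c})"
    and a1_deriv: "\<And>t. t \<in> {0..<\<tau>\<^sub>c} \<Longrightarrow> (a1 has_real_derivative a2 t) (at t within {0..<\<tau>\<^sub>c})"
    and a2_deriv: "\<And>t. t \<in> {0..<\<tau>\<^sub>c} \<Longrightarrow> (a2 has_real_derivative a3 t) (at t within {0..<\<tau>\<^sub>c})"
begin

abbreviation "S \<equiv> interior_region \<chi>\<^sub>s \<tau>\<^sub>c"
abbreviation "g \<equiv> interior_metric k a"

lemma interior_region_D:
  assumes "x \<in> S"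
  shows "x $ 1 \<in> {0..<\<tau>\<^sub>c}" "x $ 2 > 0" "x $ 2 \<le> \<chi>\<^sub>s" "a (x $ 1) \<noteq> 0" "1 - k * (x $ 2)\<^sup>2 \<noteq> 0"
    "1 \<noteq> k * (x $ 2)\<^sup>2" "sin (x $ 3) \<noteq> 0" "x $ 2 \<noteq> 0"
proof -
  show *: "x $ 1 \<in> {0..<\<tau>\<^sub>c}" "x $ 2 > 0" "x $ 2 \<le> \<chi>\<^sub>s"
    using assms by (auto simp: interior_region_def)
  then show "x $ 2 \<noteq> 0" by simp
  show "a (x $ 1) \<noteq> 0" using a_pos[OF *(1)] by simp
  \<comment> \<open>\<open>curv_pos\<close> speaks of the surface only; further in, the product is
    either nonpositive or bounded by its value at the surface.\<close>
  have "k * (x $ 2)\<^sup>2 < 1"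
  proof (cases "k \<le> 0")
    case True
    then have "k * (x $ 2)\<^sup>2 \<le> 0" by (simp add: mult_nonpos_nonneg)
    then show ?thesis by linarith
  next
    case False
    have "k * (x $ 2)\<^sup>2 \<le> k * \<chi>\<^sub>s\<^sup>2" using False * by (intro mult_left_mono power_mono) auto
    then show ?thesis using curv_pos by linarith
  qed
  then show "1 - k * (x $ 2)\<^sup>2 \<noteq> 0" "1 \<noteq> k * (x $ 2)\<^sup>2" by auto
  have "0 < x $ 3" "x $ 3 < pi" using assms by (auto simp: interior_region_def)
  then show "sin (x $ 3) \<noteq> 0" using sin_gt_zero by force
qed

section \<open>The interior chart as a product of intervals\<close>

lemma S_box:
  "S = {x. \<forall>j. x $ j \<in> vector [{0..<\<tau>\<^sub>c}, {0<..\<chi>\<^sub>s}, {0<..<pi}, UNIV] $ j}"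
  by (auto simp: interior_region_def forall_4)

text \<open>The chart contains boundary points, \<tau> = 0 and the stellar surface itself; one-sided
  derivatives there are still unique because these are limit points of their intervals.\<close>

lemma at_within_box_nontrivial:
  assumes "x \<in> S"
  shows "at (x $ i) within vector [{0..<\<tau>\<^sub>c}, {0<..\<chi>\<^sub>s}, {0<..<pi}, UNIV] $ i \<noteq> bot"
proof -
  note x = interior_region_D(1-3)[OF assms]
  have "x $ 1 islimpt {0..<\<tau>\<^sub>c}"
    using x \<tau>\<^sub>c_pos by simp
  moreover have "x $ 2 islimpt {0<..\<chi>\<^sub>s}"
    using x \<chi>\<^sub>s_pos by simp
  moreover have "x $ 3 islimpt {0<..<pi}"
    using assms by (intro interior_limit_point) (simp add: interior_region_def)
  ultimately show ?thesis
    using exhaust_4[of i] by (auto simp: trivial_limit_within)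
qed

lemmas partial_S = partial_eq[OF S_box _ at_within_box_nontrivial]

text \<open>Nothing depends on the azimuth, hence three arguments for \<open>G\<close>. Only the
  time derivative is taken within an interval, since \<open>a\<close> is controlled only there; the
  dependence on the other coordinates is elementary, and a two-sided derivative restricts to the
  surface.\<close>

lemma partial_1:
  assumes "x \<in> S" "\<And>z. z \<in> S \<Longrightarrow> F z = G (z $ 1) (z $ 2) (z $ 3)"
    "((\<lambda>t. G t (x $ 2) (x $ 3)) has_real_derivative D) (at (x $ 1) within {0..<\<tau>\<^sub>c})"
  shows "partial S 1 F x = D"
  using partial_S[where x = x and i = 1 and F = F and G = "\<lambda>z. G (z $ 1) (z $ 2) (z $ 3)" and D = D] assms by simp

lemma partial_2:
  assumes "x \<in> S" "\<And>z. z \<in> S \<Longrightarrow> F z = G (z $ 1) (z $ 2) (z $ 3)"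
    "((\<lambda>t. G (x $ 1) t (x $ 3)) has_real_derivative D) (at (x $ 2))"
  shows "partial S 2 F x = D"
  using partial_S[where x = x and i = 2 and F = F and G = "\<lambda>z. G (z $ 1) (z $ 2) (z $ 3)" and D = D] assms
  by (simp add: has_field_derivative_at_within)

lemma partial_3:
  assumes "x \<in> S" "\<And>z. z \<in> S \<Longrightarrow> F z = G (z $ 1) (z $ 2) (z $ 3)"
    "((\<lambda>t. G (x $ 1) (x $ 2) t) has_real_derivative D) (at (x $ 3))"
  shows "partial S 3 F x = D"
  using partial_S[where x = x and i = 3 and F = F and G = "\<lambda>z. G (z $ 1) (z $ 2) (z $ 3)" and D = D] assms
  by (simp add: has_field_derivative_at_within)

lemma partial_4:
  assumes "x \<in> S" "\<And>z. z \<in> S \<Longrightarrow> F z = G (z $ 1) (z $ 2) (z $ 3)"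
  shows "partial S 4 F x = 0"
  using partial_S[where x = x and i = 4 and F = F and G = "\<lambda>z. G (z $ 1) (z $ 2) (z $ 3)" and D = 0] assms by simp

lemma partial_const:
  assumes "x \<in> S" "\<And>z. z \<in> S \<Longrightarrow> F z = c"
  shows "partial S i F x = 0"
  using partial_S[where x = x and i = i and F = F and G = "\<lambda>_. c" and D = 0] assms by simp

section \<open>Inverse metric and connection of the interior\<close>

lemma metric_inv:
  assumes "x \<in> S"
  shows "matrix_inv (g x) = diag_matrix (vector [1, - ((1 - k * (x $ 2)\<^sup>2) / (a (x $ 1))\<^sup>2),
    - (1 / ((a (x $ 1))\<^sup>2 * (x $ 2)\<^sup>2)), - (1 / ((a (x $ 1))\<^sup>2 * (x $ 2)\<^sup>2 * (sin (x $ 3))\<^sup>2))])"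
proof -
  note [simp] = interior_region_D(4-)[OF assms]
  let ?d = "vector [1, - ((a (x $ 1))\<^sup>2 / (1 - k * (x $ 2)\<^sup>2)), - ((a (x $ 1))\<^sup>2 * (x $ 2)\<^sup>2),
      - ((a (x $ 1))\<^sup>2 * (x $ 2)\<^sup>2 * (sin (x $ 3))\<^sup>2)] :: real ^ 4"
  have "?d $ i \<noteq> 0" for i
    using exhaust_4[of i] by (elim disjE) simp_all
  from matrix_inv_diag_matrix[of ?d, OF this] show ?thesis
    unfolding interior_metric_def by (simp add: vec_eq_iff forall_4 diag_matrix_def)
qed

text \<open>The first index is the direction of differentiation, the second selects the diagonal
  entry of the metric.\<close>

definition metric_deriv :: "real ^ 4 \<Rightarrow> real ^ 4 ^ 4" where
  "metric_deriv x = vector [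
     vector [0, - (2 * a (x $ 1) * a1 (x $ 1) / (1 - k * (x $ 2)\<^sup>2)), - (2 * a (x $ 1) * a1 (x $ 1) * (x $ 2)\<^sup>2),
       - (2 * a (x $ 1) * a1 (x $ 1) * (x $ 2)\<^sup>2 * (sin (x $ 3))\<^sup>2)],
     vector [0, - ((a (x $ 1))\<^sup>2 * (2 * k * x $ 2) / (1 - k * (x $ 2)\<^sup>2)\<^sup>2), - ((a (x $ 1))\<^sup>2 * (2 * x $ 2)),
       - ((a (x $ 1))\<^sup>2 * (2 * x $ 2) * (sin (x $ 3))\<^sup>2)],
     vector [0, 0, 0, - ((a (x $ 1))\<^sup>2 * (x $ 2)\<^sup>2 * (2 * sin (x $ 3) * cos (x $ 3)))],
     vector [0, 0, 0, 0]]"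

lemma partial_metric:
  assumes x: "x \<in> S"
  shows "partial S \<mu> (\<lambda>z. g z $ \<sigma> $ \<nu>) x = (if \<sigma> = \<nu> then metric_deriv x $ \<mu> $ \<sigma> else 0)"
proof (cases "\<sigma> = \<nu>")
  case False
  then show ?thesis
    using partial_const[OF x, of _ 0] by (simp add: interior_metric_def diag_matrix_def)
next
  case True
  note [derivative_intros] = a_deriv[OF interior_region_D(1)[OF x]]
  note [simp] = interior_region_D(4-)[OF x]
  have 1: "partial S i (\<lambda>z. g z $ 1 $ 1) x = 0" for i
    by (rule partial_const[OF x, of _ 1]) (simp add: interior_metric_def diag_matrix_def)
  let ?G2 = "\<lambda>t c h. - ((a t)\<^sup>2 / (1 - k * c\<^sup>2))"
  let ?G3 = "\<lambda>t c h. - ((a t)\<^sup>2 * c\<^sup>2)"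
  let ?G4 = "\<lambda>t c h. - ((a t)\<^sup>2 * c\<^sup>2 * (sin h)\<^sup>2)"
  have G: "g z $ 2 $ 2 = ?G2 (z $ 1) (z $ 2) (z $ 3)" "g z $ 3 $ 3 = ?G3 (z $ 1) (z $ 2) (z $ 3)"
    "g z $ 4 $ 4 = ?G4 (z $ 1) (z $ 2) (z $ 3)" for z
    by (simp_all add: interior_metric_def diag_matrix_def)
  have "partial S 1 (\<lambda>z. g z $ 2 $ 2) x = metric_deriv x $ 1 $ 2"
    by (rule partial_1[OF x, where G = ?G2, OF G(1)], (rule derivative_eq_intros refl | simp)+)
      (simp_all add: metric_deriv_def power2_eq_square field_simps)
  moreover have "partial S 1 (\<lambda>z. g z $ 3 $ 3) x = metric_deriv x $ 1 $ 3"
    by (rule partial_1[OF x, where G = ?G3, OF G(2)], (rule derivative_eq_intros refl | simp)+)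
      (simp_all add: metric_deriv_def power2_eq_square field_simps)
  moreover have "partial S 1 (\<lambda>z. g z $ 4 $ 4) x = metric_deriv x $ 1 $ 4"
    by (rule partial_1[OF x, where G = ?G4, OF G(3)], (rule derivative_eq_intros refl | simp)+)
      (simp_all add: metric_deriv_def power2_eq_square field_simps)
  moreover have "partial S 2 (\<lambda>z. g z $ 2 $ 2) x = metric_deriv x $ 2 $ 2"
    by (rule partial_2[OF x, where G = ?G2, OF G(1)], (rule derivative_eq_intros refl | simp)+)
      (simp_all add: metric_deriv_def power2_eq_square field_simps)
  moreover have "partial S 2 (\<lambda>z. g z $ 3 $ 3) x = metric_deriv x $ 2 $ 3"
    by (rule partial_2[OF x, where G = ?G3, OF G(2)], (rule derivative_eq_intros refl | simp)+)
      (simp_all add: metric_deriv_def power2_eq_square field_simps)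
  moreover have "partial S 2 (\<lambda>z. g z $ 4 $ 4) x = metric_deriv x $ 2 $ 4"
    by (rule partial_2[OF x, where G = ?G4, OF G(3)], (rule derivative_eq_intros refl | simp)+)
      (simp_all add: metric_deriv_def power2_eq_square field_simps)
  moreover have "partial S 3 (\<lambda>z. g z $ 2 $ 2) x = metric_deriv x $ 3 $ 2"
    by (rule partial_3[OF x, where G = ?G2, OF G(1)], (rule derivative_eq_intros refl | simp)+)
      (simp_all add: metric_deriv_def power2_eq_square field_simps)
  moreover have "partial S 3 (\<lambda>z. g z $ 3 $ 3) x = metric_deriv x $ 3 $ 3"
    by (rule partial_3[OF x, where G = ?G3, OF G(2)], (rule derivative_eq_intros refl | simp)+)
      (simp_all add: metric_deriv_def power2_eq_square field_simps)
  moreover have "partial S 3 (\<lambda>z. g z $ 4 $ 4) x = metric_deriv x $ 3 $ 4"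
    by (rule partial_3[OF x, where G = ?G4, OF G(3)], (rule derivative_eq_intros refl | simp)+)
      (simp_all add: metric_deriv_def power2_eq_square field_simps)
  moreover have
    "partial S 4 (\<lambda>z. g z $ 2 $ 2) x = 0" "partial S 4 (\<lambda>z. g z $ 3 $ 3) x = 0"
    "partial S 4 (\<lambda>z. g z $ 4 $ 4) x = 0"
    using partial_4[OF x, where G = ?G2, OF G(1)] partial_4[OF x, where G = ?G3, OF G(2)]
      partial_4[OF x, where G = ?G4, OF G(3)] by simp_all
  ultimately have "\<forall>\<mu> \<sigma>. partial S \<mu> (\<lambda>z. g z $ \<sigma> $ \<sigma>) x = metric_deriv x $ \<mu> $ \<sigma>"
    unfolding forall_4 1 by (simp add: metric_deriv_def)
  then show ?thesis using True by simp
qed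

text \<open>The outermost index is the upper one.\<close>

definition flrw_christoffel :: "real ^ 4 \<Rightarrow> real ^ 4 ^ 4 ^ 4" where
  "flrw_christoffel x = (let b = a (x $ 1); b1 = a1 (x $ 1); c = x $ 2; h = x $ 3 in vector [
     vector [
       vector [0, 0, 0, 0],
       vector [0, b * b1 / (1 - k * c\<^sup>2), 0, 0],
       vector [0, 0, b * b1 * c\<^sup>2, 0],
       vector [0, 0, 0, b * b1 * c\<^sup>2 * (sin h)\<^sup>2]],
     vector [
       vector [0, b1 / b, 0, 0],
       vector [b1 / b, k * c / (1 - k * c\<^sup>2), 0, 0],
       vector [0, 0, - (c * (1 - k * c\<^sup>2)), 0],
       vector [0, 0, 0, - (c * (1 - k * c\<^sup>2) * (sin h)\<^sup>2)]],
     vector [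
       vector [0, 0, b1 / b, 0],
       vector [0, 0, 1 / c, 0],
       vector [b1 / b, 1 / c, 0, 0],
       vector [0, 0, 0, - (sin h * cos h)]],
     vector [
       vector [0, 0, 0, b1 / b],
       vector [0, 0, 0, 1 / c],
       vector [0, 0, 0, cos h / sin h],
       vector [b1 / b, 1 / c, cos h / sin h, 0]]])"

text \<open>A diagonal inverse metric reduces the contraction to one term; what remains is a check
  of the 64 index triples.\<close>

lemma christoffel_eq:
  assumes x: "x \<in> S"
  shows "christoffel S g \<rho> \<mu> \<nu> x = flrw_christoffel x $ \<rho> $ \<mu> $ \<nu>"
proof -
  note [simp] = interior_region_D(4-)[OF x]
  have "christoffel S g \<rho> \<mu> \<nu> x = matrix_inv (g x) $ \<rho> $ \<rho> *
     ((if \<rho> = \<nu> then metric_deriv x $ \<mu> $ \<rho> else 0) + (if \<rho> = \<mu> then metric_deriv x $ \<nu> $ \<rho> else 0)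
       - (if \<mu> = \<nu> then metric_deriv x $ \<rho> $ \<mu> else 0)) / 2"
    unfolding christoffel_def partial_metric[OF x] metric_inv[OF x]
    by (simp add: diag_matrix_def if_distrib[of "\<lambda>u. u * _"] cong: if_cong)
  also have "\<dots> = flrw_christoffel x $ \<rho> $ \<mu> $ \<nu>"
    unfolding metric_inv[OF x] diag_matrix_def metric_deriv_def flrw_christoffel_def Let_def
    using exhaust_4[of \<rho>] exhaust_4[of \<mu>] exhaust_4[of \<nu>]
    by (elim disjE; simp; simp add: divide_simps power2_eq_square)
  finally show ?thesis .
qed

lemma partial_christoffel_zero:
  assumes "x \<in> S" "\<And>z. flrw_christoffel z $ \<rho> $ \<mu> $ \<nu> = 0"
  shows "partial S i (christoffel S g \<rho> \<mu> \<nu>) x = 0"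
  using partial_const[of x "christoffel S g \<rho> \<mu> \<nu>" 0] assms by (simp add: christoffel_eq)

text \<open>A diagonal component of the Ricci tensor involves only \<partial>_\<mu>
  \<Gamma>^\<alpha>_\<mu>\<alpha> and \<partial>_\<alpha> \<Gamma>^\<alpha>_\<mu>\<mu>. This lemma
  and the next two list those that neither vanish nor cancel. The diagonal is enough for the scalar,
  because the inverse metric is diagonal.\<close>

lemma partial_1_christoffel:
  assumes x: "x \<in> S"
  defines "b \<equiv> a (x $ 1)" and "b1 \<equiv> a1 (x $ 1)" and "b2 \<equiv> a2 (x $ 1)"
  shows "partial S 1 (christoffel S g 2 1 2) x = (b2 * b - b1\<^sup>2) / b\<^sup>2"
    "partial S 1 (christoffel S g 3 1 3) x = (b2 * b - b1\<^sup>2) / b\<^sup>2"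
    "partial S 1 (christoffel S g 4 1 4) x = (b2 * b - b1\<^sup>2) / b\<^sup>2"
    "partial S 1 (christoffel S g 1 2 2) x = (b1\<^sup>2 + b * b2) / (1 - k * (x $ 2)\<^sup>2)"
    "partial S 1 (christoffel S g 1 3 3) x = (b1\<^sup>2 + b * b2) * (x $ 2)\<^sup>2"
    "partial S 1 (christoffel S g 1 4 4) x = (b1\<^sup>2 + b * b2) * (x $ 2)\<^sup>2 * (sin (x $ 3))\<^sup>2"
proof -
  note [derivative_intros] = a_deriv[OF interior_region_D(1)[OF x]] a1_deriv[OF interior_region_D(1)[OF x]]
  note [simp] = interior_region_D(4-)[OF x]
  note defs = christoffel_eq flrw_christoffel_def Let_def
  have *: "((\<lambda>t. a1 t / a t) has_real_derivative (b2 * b - b1\<^sup>2) / b\<^sup>2) (at (x $ 1) within {0..<\<tau>\<^sub>c})"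
    unfolding b_def b1_def b2_def by (rule derivative_eq_intros refl | simp add: power2_eq_square)+
  show "partial S 1 (christoffel S g 2 1 2) x = (b2 * b - b1\<^sup>2) / b\<^sup>2"
    by (rule partial_1[OF x _ *]) (simp add: defs)
  show "partial S 1 (christoffel S g 3 1 3) x = (b2 * b - b1\<^sup>2) / b\<^sup>2"
    by (rule partial_1[OF x _ *]) (simp add: defs)
  show "partial S 1 (christoffel S g 4 1 4) x = (b2 * b - b1\<^sup>2) / b\<^sup>2"
    by (rule partial_1[OF x _ *]) (simp add: defs)
  have *: "((\<lambda>t. a t * a1 t) has_real_derivative b1\<^sup>2 + b * b2) (at (x $ 1) within {0..<\<tau>\<^sub>c})"
    unfolding b_def b1_def b2_def by (rule derivative_eq_intros refl | simp add: power2_eq_square)+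
  show "partial S 1 (christoffel S g 1 2 2) x = (b1\<^sup>2 + b * b2) / (1 - k * (x $ 2)\<^sup>2)"
    by (rule partial_1[OF x, where G = "\<lambda>t c h. a t * a1 t / (1 - k * c\<^sup>2)"])
      (simp add: defs, rule DERIV_cdivide[OF *])
  show "partial S 1 (christoffel S g 1 3 3) x = (b1\<^sup>2 + b * b2) * (x $ 2)\<^sup>2"
    by (rule partial_1[OF x, where G = "\<lambda>t c h. a t * a1 t * c\<^sup>2"])
      (simp add: defs, rule DERIV_cmult_right[OF *])
  show "partial S 1 (christoffel S g 1 4 4) x = (b1\<^sup>2 + b * b2) * (x $ 2)\<^sup>2 * (sin (x $ 3))\<^sup>2"
    by (rule partial_1[OF x, where G = "\<lambda>t c h. a t * a1 t * c\<^sup>2 * (sin h)\<^sup>2"])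
      (simp add: defs, rule DERIV_cmult_right[OF DERIV_cmult_right[OF *]])
qed

lemma partial_2_christoffel:
  assumes x: "x \<in> S"
  shows "partial S 2 (christoffel S g 3 2 3) x = - 1 / (x $ 2)\<^sup>2"
    "partial S 2 (christoffel S g 4 2 4) x = - 1 / (x $ 2)\<^sup>2"
    "partial S 2 (christoffel S g 2 3 3) x = - (1 - 3 * k * (x $ 2)\<^sup>2)"
    "partial S 2 (christoffel S g 2 4 4) x = - (1 - 3 * k * (x $ 2)\<^sup>2) * (sin (x $ 3))\<^sup>2"
proof -
  note [simp] = interior_region_D(4-)[OF x]
  note defs = christoffel_eq flrw_christoffel_def Let_def
  have *: "((\<lambda>c. 1 / c) has_real_derivative - 1 / (x $ 2)\<^sup>2) (at (x $ 2))"
    by (rule derivative_eq_intros refl | simp add: power2_eq_square)+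
  show "partial S 2 (christoffel S g 3 2 3) x = - 1 / (x $ 2)\<^sup>2"
    by (rule partial_2[OF x _ *]) (simp add: defs)
  show "partial S 2 (christoffel S g 4 2 4) x = - 1 / (x $ 2)\<^sup>2"
    by (rule partial_2[OF x _ *]) (simp add: defs)
  have *: "((\<lambda>c. - (c * (1 - k * c\<^sup>2))) has_real_derivative - (1 - 3 * k * (x $ 2)\<^sup>2)) (at (x $ 2))"
    by (rule derivative_eq_intros refl | simp add: power2_eq_square)+
  show "partial S 2 (christoffel S g 2 3 3) x = - (1 - 3 * k * (x $ 2)\<^sup>2)"
    by (rule partial_2[OF x _ *]) (simp add: defs)
  show "partial S 2 (christoffel S g 2 4 4) x = - (1 - 3 * k * (x $ 2)\<^sup>2) * (sin (x $ 3))\<^sup>2"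
    by (rule partial_2[OF x, where G = "\<lambda>t c h. - (c * (1 - k * c\<^sup>2)) * (sin h)\<^sup>2"])
      (simp add: defs, rule DERIV_cmult_right[OF *])
qed

lemma partial_3_christoffel:
  assumes x: "x \<in> S"
  shows "partial S 3 (christoffel S g 4 3 4) x = - 1 / (sin (x $ 3))\<^sup>2"
    "partial S 3 (christoffel S g 3 4 4) x = (sin (x $ 3))\<^sup>2 - (cos (x $ 3))\<^sup>2"
proof -
  note [simp] = interior_region_D(4-)[OF x]
  note defs = christoffel_eq flrw_christoffel_def Let_def
  have "(sin (x $ 3))\<^sup>2 + (cos (x $ 3))\<^sup>2 = 1" by simp
  then have *: "((\<lambda>h. cos h / sin h) has_real_derivative - 1 / (sin (x $ 3))\<^sup>2) (at (x $ 3))"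
    by - (rule derivative_eq_intros refl | simp add: power2_eq_square; algebra)+
  show "partial S 3 (christoffel S g 4 3 4) x = - 1 / (sin (x $ 3))\<^sup>2"
    by (rule partial_3[OF x _ *]) (simp add: defs)
  have *: "((\<lambda>h. - (sin h * cos h)) has_real_derivative (sin (x $ 3))\<^sup>2 - (cos (x $ 3))\<^sup>2) (at (x $ 3))"
    by (rule derivative_eq_intros refl | simp add: power2_eq_square)+
  show "partial S 3 (christoffel S g 3 4 4) x = (sin (x $ 3))\<^sup>2 - (cos (x $ 3))\<^sup>2"
    by (rule partial_3[OF x _ *]) (simp add: defs)
qed

lemma partial_4_christoffel:
  assumes x: "x \<in> S"
  shows "partial S 4 (christoffel S g \<rho> \<mu> \<nu>) x = 0"
proof (rule partial_4[OF x])
  \<comment> \<open>The 0 is an arbitrary azimuth: \<open>flrw_christoffel\<close> reads only the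
    first three coordinates.\<close>
  show "christoffel S g \<rho> \<mu> \<nu> z =
      (\<lambda>t c h. flrw_christoffel (vector [t, c, h, 0]) $ \<rho> $ \<mu> $ \<nu>) (z $ 1) (z $ 2) (z $ 3)"
    if "z \<in> S" for z
    using that by (simp add: christoffel_eq flrw_christoffel_def)
qed

section \<open>Ricci tensor and scalar curvature of the interior\<close>

lemma ricci_eq:
  assumes x: "x \<in> S"
  defines "b \<equiv> a (x $ 1)" and "b1 \<equiv> a1 (x $ 1)" and "b2 \<equiv> a2 (x $ 1)"
  shows "ricci S g 1 1 x = 3 * b2 / b"
    "ricci S g 2 2 x = - (b * b2 + 2 * b1\<^sup>2 + 2 * k) / (1 - k * (x $ 2)\<^sup>2)"
    "ricci S g 3 3 x = - (b * b2 + 2 * b1\<^sup>2 + 2 * k) * (x $ 2)\<^sup>2"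
    "ricci S g 4 4 x = - (b * b2 + 2 * b1\<^sup>2 + 2 * k) * (x $ 2)\<^sup>2 * (sin (x $ 3))\<^sup>2"
proof -
  have nz: "b \<noteq> 0" "1 - k * (x $ 2)\<^sup>2 \<noteq> 0" "1 \<noteq> k * (x $ 2)\<^sup>2" "sin (x $ 3) \<noteq> 0" "x $ 2 \<noteq> 0"
    using interior_region_D[OF x] by (auto simp: b_def)
  note [simp] = nz
  note defs = ricci_def riemann_def sum_4 christoffel_eq[OF x] partial_christoffel_zero[OF x]
    partial_1_christoffel[OF x, folded b_def b1_def b2_def] partial_2_christoffel[OF x]
    partial_3_christoffel[OF x] partial_4_christoffel[OF x]
  note G = flrw_christoffel_def Let_def b_def[symmetric] b1_def[symmetric] b2_def[symmetric]
  have sc: "(cos (x $ 3))\<^sup>2 = 1 - (sin (x $ 3))\<^sup>2" by (simp add: cos_squared_eq)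
  show "ricci S g 1 1 x = 3 * b2 / b"
    by (simp add: defs G) (simp add: field_simps power2_eq_square)
  show "ricci S g 2 2 x = - (b * b2 + 2 * b1\<^sup>2 + 2 * k) / (1 - k * (x $ 2)\<^sup>2)"
    by (simp add: defs G sc) (simp add: divide_simps; algebra)
  show "ricci S g 3 3 x = - (b * b2 + 2 * b1\<^sup>2 + 2 * k) * (x $ 2)\<^sup>2"
    by (simp add: defs G) (simp add: divide_simps; algebra add: sc)
  show "ricci S g 4 4 x = - (b * b2 + 2 * b1\<^sup>2 + 2 * k) * (x $ 2)\<^sup>2 * (sin (x $ 3))\<^sup>2"
    by (simp add: defs G) algebra
qed

definition curv :: "real \<Rightarrow> real" where
  "curv t = 6 * (((a1 t)\<^sup>2 + k) / (a t)\<^sup>2 + a2 t / a t)"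

lemma ricci_scalar_eq:
  assumes x: "x \<in> S"
  shows "ricci_scalar S g x = curv (x $ 1)"
proof -
  have nz: "a (x $ 1) \<noteq> 0" "1 - k * (x $ 2)\<^sup>2 \<noteq> 0" "1 \<noteq> k * (x $ 2)\<^sup>2" "sin (x $ 3) \<noteq> 0" "x $ 2 \<noteq> 0"
    using interior_region_D[OF x] by auto
  show ?thesis
    using nz
    by (simp add: ricci_scalar_def sum_4 metric_inv[OF x] diag_matrix_def ricci_eq[OF x] curv_def)
      (simp add: field_simps power2_eq_square)
qed

lemma curv_differentiable:
  assumes "t \<in> {0..<\<tau>\<^sub>c}"
  obtains D where "(curv has_real_derivative D) (at t within {0..<\<tau>\<^sub>c})"
proof -
  have [simp]: "a t \<noteq> 0" using a_pos[OF assms] by simp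
  note [derivative_intros] = a_deriv[OF assms] a1_deriv[OF assms] a2_deriv[OF assms]
  show thesis
    by (rule that, unfold curv_def) (rule derivative_eq_intros refl | simp)+
qed

end

section \<open>Junction conditions\<close>

lemma surface_params_box:
  "surface_params \<tau>\<^sub>c = {y. \<forall>j. y $ j \<in> vector [{0..<\<tau>\<^sub>c}, {0<..<pi}, UNIV] $ j}"
  by (auto simp: surface_params_def forall_3)

lemma exterior_region_box:
  "exterior_region J = {x. \<forall>j. x $ j \<in> vector [UNIV, J, {0<..<pi}, UNIV] $ j}"
  by (auto simp: exterior_region_def forall_4)

lemma partial_surface:
  assumes y: "y \<in> surface_params \<tau>\<^sub>c"
    and "((\<lambda>t. F (\<chi> j. if j = i then t else y $ j)) has_real_derivative D)
      (at (y $ i) within vector [{0..<\<tau>\<^sub>c}, {0<..<pi}, UNIV] $ i)"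
  shows "partial (surface_params \<tau>\<^sub>c) i F y = D"
proof (rule partial_eq[OF surface_params_box y, where G = F])
  have "y $ 1 islimpt {0..<\<tau>\<^sub>c}" using y by (simp add: surface_params_def)
  moreover have "y $ 2 islimpt {0<..<pi}"
    using y by (intro interior_limit_point) (simp add: surface_params_def)
  ultimately show "at (y $ i) within vector [{0..<\<tau>\<^sub>c}, {0<..<pi}, UNIV] $ i \<noteq> bot"
    using exhaust_3[of i] by (auto simp: trivial_limit_within)
qed (use assms(2) in simp_all)

text \<open>Both embeddings have this shape, the interior one with \<open>p\<close> the identity and
  \<open>q\<close> constant. Along an angular direction \<open>p\<close> and \<open>q\<close> are
  frozen, so the two sides share these tangent vectors.\<close>

lemma tangent_angular:
  assumes y: "y \<in> surface_params \<tau>\<^sub>c"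
    and X: "\<And>y. X y = vector [p (y $ 1), q (y $ 1), y $ 2, y $ 3]"
  shows "tangent (surface_params \<tau>\<^sub>c) X 2 y = (axis 3 1 :: real ^ 4)"
    "tangent (surface_params \<tau>\<^sub>c) X 3 y = (axis 4 1 :: real ^ 4)"
  unfolding vec_eq_iff forall_4 tangent_def X vec_lambda_beta vector_4
  by (intro conjI; rule partial_surface[OF y]; simp add: axis_def)+

lemma tangent_interior_time:
  assumes y: "y \<in> surface_params \<tau>\<^sub>c"
  shows "tangent (surface_params \<tau>\<^sub>c) (interior_surface \<chi>\<^sub>s) 1 y = axis 1 1"
  unfolding vec_eq_iff forall_4 tangent_def interior_surface_def vec_lambda_beta vector_4
  by (intro conjI; rule partial_surface[OF y]; simp add: axis_def)

text \<open>With a diagonal metric, orthogonality to a coordinate vector removes that component of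
  the normal. Inside, only the radial component survives; outside, only the angular ones are
  removed.\<close>

lemma normal_orthogonal_axis:
  assumes "outward_unit_normal D g X n" "y \<in> D" "tangent D X i y = axis \<mu> 1"
    "g (X y) = diag_matrix d" "d $ \<mu> \<noteq> 0"
  shows "n y $ \<mu> = 0"
proof -
  have "tangent D X i y \<bullet> (g (X y) *v n y) = 0"
    using assms(1,2) by (auto simp: outward_unit_normal_def)
  then show ?thesis using assms(3-5) by (simp add: inner_axis')
qed

lemma induced_metric_axis:
  assumes "tangent D X i y = axis \<mu> 1" "g (X y) = diag_matrix d"
  shows "induced_metric D g X i i y = d $ \<mu>"
  using assms by (simp add: induced_metric_def inner_axis')

lemma has_real_derivative_inv_into:
  fixes r :: "real \<Rightarrow> real"
  assumes U: "open U" "t \<in> U" and r: "\<And>x. x \<in> U \<Longrightarrow> (r has_real_derivative r' x) (at x)"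
    and inj: "inj_on r U" and nz: "r' t \<noteq> 0"
  shows "(inv_into U r has_real_derivative inverse (r' t)) (at (r t))"
  unfolding has_field_derivative_def
proof (rule has_derivative_inverse_strong[OF U])
  show "continuous_on U r"
    using r by (meson DERIV_continuous continuous_at_imp_continuous_on)
  show "inv_into U r (r x) = x" if "x \<in> U" for x using inj that by simp
  show "(r has_derivative (*) (r' t)) (at t)"
    using r[OF U(2)] by (simp add: has_field_derivative_def)
  show "(*) (r' t) \<circ> (*) (inverse (r' t)) = id" using nz by (auto simp: fun_eq_iff)
qed

section \<open>Constancy of the interior curvature\<close>

context flrw_interior begin

lemma at_of_within:
  assumes "t \<in> {0<..<\<tau>\<^sub>c}" "(F has_real_derivative D) (at t within {0..<\<tau>\<^sub>c})"
  shows "(F has_real_derivative D) (at t)"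
proof -
  have "(F has_real_derivative D) (at t within {0<..<\<tau>\<^sub>c})"
    by (rule has_field_derivative_subset[OF assms(2)]) auto
  then show ?thesis using at_within_open[OF assms(1)] by simp
qed

text \<open>The exterior scalar curvature is recovered from the interior one through the radius
  \<open>r = a \<chi>\<^sub>s\<close> of the surface, so it is differentiable wherever the inverse of \<open>t \<mapsto> a t * \<chi>\<^sub>s\<close> is.\<close>

lemma curv_deriv_zero:
  assumes J: "open J" "J \<subseteq> {0<..}"
    and collapse: "\<And>t. t \<in> {0<..<\<tau>\<^sub>c} \<Longrightarrow> a1 t < 0"
    and matched: "smoothly_matched k \<chi>\<^sub>s \<tau>\<^sub>c a J A B"
    and t: "t \<in> {0<..<\<tau>\<^sub>c}"
  shows "(curv has_real_derivative 0) (at t)"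
proof -
  define D where "D = surface_params \<tau>\<^sub>c"
  define S2 where "S2 = exterior_region J"
  define g2 where "g2 = static_metric A B"
  define X1 where "X1 = interior_surface \<chi>\<^sub>s"
  obtain t\<^sub>s r\<^sub>s where r\<^sub>s: "\<And>\<tau>. \<tau> \<in> {0..<\<tau>\<^sub>c} \<Longrightarrow> r\<^sub>s \<tau> \<in> J"
    and jc: "junction_conditions D S g X1 S2 g2 (exterior_surface t\<^sub>s r\<^sub>s)"
    using matched unfolding smoothly_matched_def D_def S2_def g2_def X1_def by metis
  define X2 where "X2 = exterior_surface t\<^sub>s r\<^sub>s"
  obtain n1 n2 where n1: "outward_unit_normal D g X1 n1" and n2: "outward_unit_normal D g2 X2 n2"
    and h: "\<And>y i. y \<in> D \<Longrightarrow> induced_metric D g2 X2 i i y = induced_metric D g X1 i i y"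
    and R: "\<And>y. y \<in> D \<Longrightarrow> ricci_scalar S2 g2 (X2 y) = ricci_scalar S g (X1 y)"
    and nR: "\<And>y. y \<in> D \<Longrightarrow> normal_derivative S2 X2 n2 (ricci_scalar S2 g2) y
           = normal_derivative S X1 n1 (ricci_scalar S g) y"
    using jc unfolding junction_conditions_def X2_def by auto
  \<comment> \<open>One curve on the surface suffices; the equator avoids the axis of the spherical
    coordinates.\<close>
  define y :: "real \<Rightarrow> real ^ 3" where "y \<tau> = vector [\<tau>, pi / 2, 0]" for \<tau>
  have yD: "y \<tau> \<in> D" if "\<tau> \<in> {0..<\<tau>\<^sub>c}" for \<tau>
    using that by (simp add: D_def surface_params_def y_def)
  have X1S: "X1 (y \<tau>) \<in> S" if "\<tau> \<in> {0..<\<tau>\<^sub>c}" for \<tau>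
    using that \<chi>\<^sub>s_pos by (simp add: X1_def interior_surface_def interior_region_def y_def)
  have X2S: "X2 (y \<tau>) \<in> S2" if "\<tau> \<in> {0..<\<tau>\<^sub>c}" for \<tau>
    using that r\<^sub>s by (simp add: X2_def S2_def exterior_surface_def exterior_region_def y_def)
  have tan1: "tangent D X1 2 z = axis 3 1" "tangent D X1 3 z = axis 4 1" "tangent D X1 1 z = axis 1 1"
    if "z \<in> D" for z
    using tangent_angular[of z \<tau>\<^sub>c X1 "\<lambda>s. s" "\<lambda>_. \<chi>\<^sub>s"] tangent_interior_time[of z \<tau>\<^sub>c \<chi>\<^sub>s] that
    by (auto simp: D_def X1_def interior_surface_def)
  have tan2: "tangent D X2 2 z = axis 3 1" "tangent D X2 3 z = axis 4 1"
    if "z \<in> D" for z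
    using tangent_angular[of z \<tau>\<^sub>c X2 t\<^sub>s r\<^sub>s] that
    by (auto simp: D_def X2_def exterior_surface_def)
  have radius: "r\<^sub>s \<tau> = a \<tau> * \<chi>\<^sub>s" if \<tau>: "\<tau> \<in> {0..<\<tau>\<^sub>c}" for \<tau>
  proof -
    \<comment> \<open>This is the polar component of the induced metric; positivity of both radii
      then selects the root.\<close>
    have "(r\<^sub>s \<tau>)\<^sup>2 = (a \<tau>)\<^sup>2 * \<chi>\<^sub>s\<^sup>2"
      using h[OF yD[OF \<tau>], of 2] tan1(1)[OF yD[OF \<tau>]] tan2(1)[OF yD[OF \<tau>]]
      by (simp add: induced_metric_axis[OF _ static_metric_def] induced_metric_axis[OF _ interior_metric_def]
          g2_def X1_def X2_def y_def interior_surface_def exterior_surface_def)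
    moreover have "r\<^sub>s \<tau> > 0" using r\<^sub>s[OF \<tau>] J(2) by auto
    moreover have "a \<tau> * \<chi>\<^sub>s > 0" using a_pos[OF \<tau>] \<chi>\<^sub>s_pos by simp
    ultimately show ?thesis
      by (simp add: power2_eq_iff_nonneg flip: power_mult_distrib)
  qed
  define Q where "Q r = ricci_scalar S2 g2 (vector [0, r, pi / 2, 0])" for r
  have shift: "ricci_scalar S2 g2 (x + c *\<^sub>R axis 1 1) = ricci_scalar S2 g2 x" for x c
    by (rule ricci_scalar_translation_invariant)
      (simp_all add: S2_def g2_def exterior_region_def static_metric_def axis_def)
  have Q: "ricci_scalar S2 g2 (vector [s, r, pi / 2, 0]) = Q r" for s r
  proof -
    have "vector [s, r, pi / 2, 0] = vector [0, r, pi / 2, 0] + s *\<^sub>R (axis 1 1 :: real ^ 4)"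
      by (simp add: vec_eq_iff forall_4 axis_def)
    then show ?thesis by (simp only: shift Q_def)
  qed
  have Q_curv: "Q (a \<tau> * \<chi>\<^sub>s) = curv \<tau>" if \<tau>: "\<tau> \<in> {0..<\<tau>\<^sub>c}" for \<tau>
    using R[OF yD[OF \<tau>]] ricci_scalar_eq[OF X1S[OF \<tau>]] radius[OF \<tau>]
    by (simp add: X2_def X1_def y_def exterior_surface_def interior_surface_def Q)

  have t': "t \<in> {0..<\<tau>\<^sub>c}" using t by simp
  define r0 where "r0 = a t * \<chi>\<^sub>s"
  define x where "x = X2 (y t)"
  have x: "x \<in> S2" "x = vector [t\<^sub>s t, r0, pi / 2, 0]"
    using X2S[OF t'] radius[OF t'] by (simp_all add: x_def r0_def X2_def exterior_surface_def y_def)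
  obtain P' where P': "(curv has_real_derivative P') (at t)"
    using curv_differentiable[OF t'] at_of_within[OF t] by blast
  have Q_deriv: "(Q has_real_derivative P' * inverse (a1 t * \<chi>\<^sub>s)) (at r0)"
  proof -
    let ?U = "{0<..<\<tau>\<^sub>c}"
    define r where "r \<tau> = a \<tau> * \<chi>\<^sub>s" for \<tau>
    have r_deriv: "(r has_real_derivative a1 \<tau> * \<chi>\<^sub>s) (at \<tau>)" if "\<tau> \<in> ?U" for \<tau>
      unfolding r_def by (rule DERIV_cmult_right, rule at_of_within[OF that], rule a_deriv) (use that in auto)
    have neg: "a1 \<tau> * \<chi>\<^sub>s < 0" if "\<tau> \<in> ?U" for \<tau>
      using collapse[OF that] \<chi>\<^sub>s_pos by (simp add: mult_neg_pos)
    have "r u > r v" if "u \<in> ?U" "v \<in> ?U" "u < v" for u v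
      by (rule DERIV_neg_imp_decreasing[OF that(3)]) (use that r_deriv neg in force)
    then have inj: "inj_on r ?U" by (intro linorder_inj_onI') force
    have "continuous_on ?U r"
      using r_deriv by (meson DERIV_continuous continuous_at_imp_continuous_on)
    \<comment> \<open>The identity with \<open>Q\<close> holds only on the radii swept out; openness
      of that set is what lets the derivative be transferred.\<close>
    then have op: "open (r ` ?U)" using inj by (intro invariance_of_domain) auto
    have "(inv_into ?U r has_real_derivative inverse (a1 t * \<chi>\<^sub>s)) (at (r t))"
      using t r_deriv inj neg[OF t] by (intro has_real_derivative_inv_into) auto
    then have "((\<lambda>s. curv (inv_into ?U r s)) has_real_derivative P' * inverse (a1 t * \<chi>\<^sub>s)) (at (r t))"
      using P' inj t by (intro DERIV_chain2[where f = curv]) auto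
    then show ?thesis
      unfolding r0_def r_def[symmetric]
    proof (rule has_field_derivative_transform_within_open[OF _ op])
      show "r t \<in> r ` ?U" using t by blast
      show "curv (inv_into ?U r s) = Q s" if "s \<in> r ` ?U" for s
        using that inj Q_curv by (auto simp: r_def[symmetric])
    qed
  qed
  have "partial S2 2 (ricci_scalar S2 g2) x = 0"
  proof -
    have "n1 (y t) $ 1 = 0" "n1 (y t) $ 3 = 0" "n1 (y t) $ 4 = 0"
      using normal_orthogonal_axis[OF n1 yD[OF t'] _ interior_metric_def] tan1[OF yD[OF t']]
        a_pos[OF t'] \<chi>\<^sub>s_pos
      by (auto simp: X1_def y_def interior_surface_def)
    \<comment> \<open>A one-sided derivative, as the point lies on the boundary of the interior
      chart.\<close>
    moreover have "partial S 2 (ricci_scalar S g) (X1 (y t)) = 0"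
      by (rule partial_2[OF X1S[OF t'], where G = "\<lambda>t c h. curv t"]) (auto simp: ricci_scalar_eq)
    ultimately have "normal_derivative S2 X2 n2 (ricci_scalar S2 g2) (y t) = 0"
      using nR[OF yD[OF t']] by (simp add: normal_derivative_def sum_4)
    moreover have "n2 (y t) $ 3 = 0" "n2 (y t) $ 4 = 0"
      using normal_orthogonal_axis[OF n2[unfolded g2_def] yD[OF t'] _ static_metric_def] tan2[OF yD[OF t']]
        a_pos[OF t'] \<chi>\<^sub>s_pos radius[OF t']
      by (auto simp: X2_def y_def exterior_surface_def)
    moreover have "partial S2 1 (ricci_scalar S2 g2) x = 0"
    proof (rule partial_eq[OF exterior_region_box[of J, folded S2_def] x(1)])
      have "(\<chi> j. if j = 1 then s else x $ j) = vector [s, r0, pi / 2, 0]" for s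
        by (simp add: vec_eq_iff forall_4 x(2))
      then show "((\<lambda>s. ricci_scalar S2 g2 (\<chi> j. if j = 1 then s else x $ j)) has_real_derivative 0)
        (at (x $ 1) within vector [UNIV, J, {0<..<pi}, UNIV] $ 1)"
        by (simp add: Q)
    qed simp_all
    \<comment> \<open>The radial term is the only one left in the normal derivative, and its
      coefficient can be divided out.\<close>
    moreover have "n2 (y t) $ 2 > 0" using n2 yD[OF t'] by (auto simp: outward_unit_normal_def)
    ultimately show ?thesis by (simp add: normal_derivative_def sum_4 x_def)
  qed
  moreover have "partial S2 2 (ricci_scalar S2 g2) x = P' * inverse (a1 t * \<chi>\<^sub>s)"
  proof (rule partial_eq[OF exterior_region_box[of J, folded S2_def] x(1)])
    show "((\<lambda>t. ricci_scalar S2 g2 (\<chi> j. if j = 2 then t else x $ j)) has_real_derivative P' * inverse (a1 t * \<chi>\<^sub>s))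
      (at (x $ 2) within vector [UNIV, J, {0<..<pi}, UNIV] $ 2)"
    proof -
      have "(\<chi> j. if j = 2 then s else x $ j) = vector [t\<^sub>s t, s, pi / 2, 0]" for s
        by (simp add: vec_eq_iff forall_4 x(2))
      then show ?thesis using Q_deriv by (simp add: Q x(2) has_field_derivative_at_within)
    qed
    show "at (x $ 2) within vector [UNIV, J, {0<..<pi}, UNIV] $ (2 :: 4) \<noteq> bot"
    proof -
      have "r0 \<in> J" using r\<^sub>s[OF t'] radius[OF t'] by (simp add: r0_def)
      then have "at r0 within J \<noteq> bot" using at_within_open[OF _ J(1)] by simp
      then show ?thesis by (simp only: x(2) vector_4) simp
    qed
  qed simp
  \<comment> \<open>The same partial derivative has been found to be 0 and \<open>P'\<close> divided
    by the nonzero speed of the radius.\<close>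
  ultimately have "P' = 0" using collapse[OF t] \<chi>\<^sub>s_pos by simp
  then show ?thesis using P' by simp
qed

text \<open>A vanishing derivative in the open interval and continuity up to 0 are enough, so the
  instant of rest is included.\<close>

lemma curv_const:
  assumes zero: "\<And>t. t \<in> {0<..<\<tau>\<^sub>c} \<Longrightarrow> (curv has_real_derivative 0) (at t)" and t: "t \<in> {0..<\<tau>\<^sub>c}"
  shows "curv t = curv 0"
proof (cases "t = 0")
  case False
  show ?thesis
  proof (rule DERIV_isconst_end[of 0 t curv])
    have "continuous_on {0..<\<tau>\<^sub>c} curv"
      using curv_differentiable by (meson DERIV_continuous continuous_on_eq_continuous_within)
    then show "continuous_on {0..t} curv" by (rule continuous_on_subset) (use t in auto)
  qed (use False t zero in auto)
qed simp

section \<open>Trace of the field equations at constant curvature\<close>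

lemma trace_field_equations:
  assumes feq: "field_equations I f \<kappa> S g (dust_tensor g \<rho> (\<lambda>x. axis 1 1))"
    and R: "\<And>z. z \<in> S \<Longrightarrow> ricci_scalar S g z = R\<^sub>0" and x: "x \<in> S"
  shows "deriv_on I f R\<^sub>0 * R\<^sub>0 - 2 * f R\<^sub>0 = - \<kappa> * \<rho> x"
proof -
  define f\<^sub>R where "f\<^sub>R = (\<lambda>z. deriv_on I f (ricci_scalar S g z))"
  have "f\<^sub>R z = deriv_on I f R\<^sub>0" if "z \<in> S" for z using R[OF that] by (simp add: f\<^sub>R_def)
  then have d0: "partial S i f\<^sub>R z = 0" if "z \<in> S" for i z using partial_const that by blast
  \<comment> \<open>The first derivatives vanish on the whole chart, boundary included, hence so do
    the second ones and the connection terms.\<close>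
  have "hessian S g f\<^sub>R \<mu> \<nu> z = 0" if "z \<in> S" for \<mu> \<nu> z
    using partial_const[OF that d0] d0[OF that] by (simp add: hessian_def)
  then have "hessian S g f\<^sub>R \<mu> \<nu> x = 0" "box S g f\<^sub>R x = 0" for \<mu> \<nu>
    using x by (simp_all add: box_def)
  moreover have "f\<^sub>R x * ricci S g \<mu> \<nu> x - 1/2 * f (ricci_scalar S g x) * g x $ \<mu> $ \<nu>
      + (hessian S g f\<^sub>R \<mu> \<nu> x - g x $ \<mu> $ \<nu> * box S g f\<^sub>R x)
      = - \<kappa> * dust_tensor g \<rho> (\<lambda>x. axis 1 1) \<mu> \<nu> x" for \<mu> \<nu>
    using feq x unfolding field_equations_def Let_def f\<^sub>R_def by blast
  ultimately have eq: "deriv_on I f R\<^sub>0 * ricci S g \<mu> \<nu> x - 1/2 * f R\<^sub>0 * g x $ \<mu> $ \<nu>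
      = - \<kappa> * dust_tensor g \<rho> (\<lambda>x. axis 1 1) \<mu> \<nu> x" for \<mu> \<nu>
    using R[OF x] by (simp add: f\<^sub>R_def)
  \<comment> \<open>Four such products, each weighted by \<open>1/2\<close>, produce the coefficient
    2 of \<open>f\<close> in the trace.\<close>
  have inv: "matrix_inv (g x) $ i $ i * g x $ i $ i = 1" for i
    unfolding metric_inv[OF x] unfolding interior_metric_def diag_matrix_def
    using exhaust_4[of i] interior_region_D(4-)[OF x] by (elim disjE) (simp_all add: divide_simps)
  \<comment> \<open>The dust is at rest in these coordinates and the time entry of the metric is 1,
    so the trace of the source is the density itself.\<close>
  have T: "dust_tensor g \<rho> (\<lambda>x. axis 1 1) i i x = (if i = 1 then \<rho> x else 0)" for i
    unfolding dust_tensor_def interior_metric_def using exhaust_4[of i] by (auto simp: axis_def)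
  have contract: "matrix_inv (g x) $ i $ i * (deriv_on I f R\<^sub>0 * ricci S g i i x)
      = 1/2 * f R\<^sub>0 * (matrix_inv (g x) $ i $ i * g x $ i $ i)
        - \<kappa> * (matrix_inv (g x) $ i $ i * (if i = 1 then \<rho> x else 0))" for i
  proof -
    have "deriv_on I f R\<^sub>0 * ricci S g i i x
        = 1/2 * f R\<^sub>0 * g x $ i $ i - \<kappa> * (if i = 1 then \<rho> x else 0)"
      using eq[of i i, unfolded T] by linarith
    then show ?thesis by (simp only: right_diff_distrib) (simp only: ac_simps)
  qed
  have "R\<^sub>0 = (\<Sum>i\<in>UNIV. matrix_inv (g x) $ i $ i * ricci S g i i x)"
    unfolding R[OF x, symmetric] ricci_scalar_def metric_inv[OF x]
    by (simp add: sum_4 diag_matrix_def)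
  then have "deriv_on I f R\<^sub>0 * R\<^sub>0
      = (\<Sum>i\<in>UNIV. matrix_inv (g x) $ i $ i * (deriv_on I f R\<^sub>0 * ricci S g i i x))"
    by (simp add: sum_4 distrib_left mult.left_commute del: mult_eq_0_iff mult_cancel_left)
  also have "\<dots> = 2 * f R\<^sub>0 - \<kappa> * \<rho> x"
    unfolding contract inv by (simp add: sum_4 metric_inv[OF x] diag_matrix_def)
  finally show ?thesis by simp
qed

end

section \<open>Contradiction with the growing density\<close>

theorem mainTheorem2:
  fixes f :: "real \<Rightarrow> real" and I :: "real set"
    and \<kappa> k \<rho>\<^sub>0 \<chi>\<^sub>s \<tau>\<^sub>c :: real and a :: "real \<Rightarrow> real"
  assumes "\<kappa> > 0"
    and "nonlinear_model I f"
    and "collapsing_dust_star I f \<kappa> k \<rho>\<^sub>0 \<chi>\<^sub>s \<tau>\<^sub>c a"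
  shows "\<not> (\<exists>J A B. static_vacuum_exterior I f \<kappa> J A B \<and> smoothly_matched k \<chi>\<^sub>s \<tau>\<^sub>c a J A B)"
proof
  assume "\<exists>J A B. static_vacuum_exterior I f \<kappa> J A B \<and> smoothly_matched k \<chi>\<^sub>s \<tau>\<^sub>c a J A B"
  then obtain J A B where J: "open J" "J \<subseteq> {0<..}"
    and matched: "smoothly_matched k \<chi>\<^sub>s \<tau>\<^sub>c a J A B"
    by (auto simp: static_vacuum_exterior_def)
  let ?T = "{0..<\<tau>\<^sub>c}"
  let ?a1 = "deriv_on ?T a"
  have pos: "\<rho>\<^sub>0 > 0" "\<chi>\<^sub>s > 0" "1 - k * \<chi>\<^sub>s\<^sup>2 > 0" "\<tau>\<^sub>c > 0" "\<And>\<tau>. \<tau> \<in> ?T \<Longrightarrow> a \<tau> > 0"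
    and smooth: "smooth_on ?T a" and collapse: "\<And>\<tau>. \<tau> \<in> {0<..<\<tau>\<^sub>c} \<Longrightarrow> ?a1 \<tau> < 0"
    and feq: "field_equations I f \<kappa> (interior_region \<chi>\<^sub>s \<tau>\<^sub>c) (interior_metric k a)
       (dust_tensor (interior_metric k a) (\<lambda>x. \<rho>\<^sub>0 / a (x $ 1) ^ 3) (\<lambda>x. axis 1 1))"
    using assms(3) unfolding collapsing_dust_star_def by auto
  have "at \<tau> within ?T \<noteq> bot" if "\<tau> \<in> ?T" for \<tau>
    using that by (simp add: trivial_limit_within)
  then obtain a2 a3 where derivs:
    "\<And>\<tau>. \<tau> \<in> ?T \<Longrightarrow> (a has_real_derivative ?a1 \<tau>) (at \<tau> within ?T)"
    "\<And>\<tau>. \<tau> \<in> ?T \<Longrightarrow> (?a1 has_real_derivative a2 \<tau>) (at \<tau> within ?T)"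
    "\<And>\<tau>. \<tau> \<in> ?T \<Longrightarrow> (a2 has_real_derivative a3 \<tau>) (at \<tau> within ?T)"
    using smooth_on_derivs[OF smooth] by blast
  interpret flrw_interior k \<chi>\<^sub>s \<tau>\<^sub>c a ?a1 a2 a3
    by unfold_locales (fact pos derivs)+
  have const: "curv \<tau> = curv 0" if "\<tau> \<in> ?T" for \<tau>
    by (rule curv_const[OF _ that], rule curv_deriv_zero[OF J _ matched]) (erule collapse | assumption)+
  have R: "ricci_scalar S g x = curv 0" if "x \<in> S" for x
    unfolding ricci_scalar_eq[OF that] by (rule const[OF interior_region_D(1)[OF that]])
  have trace: "deriv_on I f (curv 0) * curv 0 - 2 * f (curv 0) = - \<kappa> * (\<rho>\<^sub>0 / a (x $ 1) ^ 3)"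
    if "x \<in> S" for x
    by (rule trace_field_equations[OF feq]) (fact R that)+
  define x :: "real \<Rightarrow> real ^ 4" where "x \<tau> = vector [\<tau>, \<chi>\<^sub>s, pi / 2, 0]" for \<tau>
  have x: "x \<tau> \<in> S" if "\<tau> \<in> ?T" for \<tau>
    using that pos by (simp add: x_def interior_region_def)
  \<comment> \<open>Any instant strictly between 0 and \<open>\<tau>\<^sub>c\<close> would serve for
    the comparison with the initial density.\<close>
  let ?t = "\<tau>\<^sub>c / 2"
  have t: "?t \<in> ?T" "0 \<in> ?T" using pos by auto
  have "\<kappa> * (\<rho>\<^sub>0 / a ?t ^ 3) = \<kappa> * (\<rho>\<^sub>0 / a 0 ^ 3)"
    using trace[OF x[OF t(1)]] trace[OF x[OF t(2)]] unfolding x_def vector_4 by linarith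
  then have "a ?t ^ 3 = a 0 ^ 3"
    using assms(1) pos(1) pos(5)[OF t(1)] pos(5)[OF t(2)] by (simp add: field_simps)
  then have "a ?t = a 0"
    using pos(5)[OF t(1)] pos(5)[OF t(2)] by (simp add: power_eq_iff_eq_base)
  moreover have "a ?t < a 0"
  \<comment> \<open>The open version is required: at 0 the derivative of \<open>a\<close> vanishes,
    and only continuity is available there.\<close>
  proof (rule DERIV_neg_imp_decreasing_open[of 0 ?t a])
    show "\<exists>y. (a has_real_derivative y) (at \<tau>) \<and> y < 0" if "0 < \<tau>" "\<tau> < ?t" for \<tau>
    proof (intro exI conjI)
      have \<tau>: "\<tau> \<in> {0<..<\<tau>\<^sub>c}" using that by auto
      then show "(a has_real_derivative ?a1 \<tau>) (at \<tau>)" by (intro at_of_within derivs) auto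
      show "?a1 \<tau> < 0" using \<tau> by (rule collapse)
    qed
    have "continuous_on ?T a"
      using derivs(1) by (meson DERIV_continuous continuous_on_eq_continuous_within)
    then show "continuous_on {0..?t} a" by (rule continuous_on_subset) (use t in auto)
  qed (use pos in auto)
  ultimately show False by simp
qed

end
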